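(* Let $\{\mathcal{F}_n,n\ge0\}$ be an increasing sequence of $\sigma$-fields and let $X_n$ $(n\ge1)$ be $\mathcal{F}_n$-measurable random variables. Let $S_n=X_1+\cdots+X_n$, $V_n^2=X_1^2+\cdots+X_n^2$ (with $V_n\ge0$) and $v_n=V_n(\log\log V_n)^{-1/2}$. For $c<d$ let $\mu_i(c,d)=E\{X_i\mathbb{1}(c\le X_i<d)\mid\mathcal{F}_{i-1}\}$. For $\lambda>0$ let $h(\lambda)$ be the positive solution $h$ of $$h-\log(1+h)=\lambda^2,$$ and let $b_\lambda=h(\lambda)/\lambda$, $\gamma=h(\lambda)/\{1+h(\lambda)\}$, $C_\gamma=-\{\gamma+\log(1-\gamma)\}/\gamma^2$ and $a_\lambda=\lambda/(\gamma C_\gamma)$. Then for every $\lambda>0$, $$\limsup_{n\to\infty}\Big\{S_n-\sum_{i=1}^n\mu_i(-\lambda v_n,a_\lambda v_n)\Big\}\Big/\{V_n(\log\log V_n)^{1/2}\}\le b_\lambda\quad\text{a.s. on }\Big\{\lim_{n\to\infty}V_n=\infty\Big\},$$ and $\lim_{\lambda\to0}b_\lambda=\sqrt2$.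
   Context: The quantity $\mu_i(-\lambda v_n,a_\lambda v_n)$ denotes the random function $(c,d)\mapsto\mu_i(c,d)$ (nonrandom arguments $c<d$, computed from a regular conditional distribution of $X_i$ given $\mathcal{F}_{i-1}$) evaluated at the random endpoints $c=-\lambda v_n$, $d=a_\lambda v_n$. The expressions involving $\log\log V_n$ are considered only for those $n$ with $V_n>e$, which is the case for all large $n$ on $\{\lim V_n=\infty\}$. No integrability of the $X_n$ is assumed. *)

theory Defs
  imports "HOL-Probability.Probability" "HOL-Real_Asymp.Real_Asymp"
begin

text \<open>
  \<open>K\<close> is a version of the regular conditional distribution of the real random variable \<open>Y\<close> given
  the sub-\<open>\<sigma>\<close>-field \<open>G\<close> of the probability space \<open>M\<close>.
\<close>

definition regular_cond_distr ::
  "'a measure \<Rightarrow> 'a measure \<Rightarrow> ('a \<Rightarrow> real) \<Rightarrow> ('a \<Rightarrow> real measure) \<Rightarrow> bool" where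
  "regular_cond_distr M G Y K \<longleftrightarrow>
     K \<in> measurable G (prob_algebra borel) \<and>
     (\<forall>B\<in>sets borel. AE \<omega> in M.
        measure (K \<omega>) B = real_cond_exp M G (indicator (Y -` B \<inter> space M)) \<omega>)"

text \<open>
  \<open>cond_trunc_mean K c d \<omega>\<close> is \<open>\<mu>(c,d)\<close> at \<open>\<omega>\<close>, computed from the kernel \<open>K\<close>; the arguments
  \<open>c\<close> and \<open>d\<close> are numbers, so that random endpoints can be substituted pointwise in \<open>\<omega>\<close>.
\<close>

definition cond_trunc_mean :: "('a \<Rightarrow> real measure) \<Rightarrow> real \<Rightarrow> real \<Rightarrow> 'a \<Rightarrow> real" where
  "cond_trunc_mean K c d \<omega> = (LINT x:{c..<d}|K \<omega>. x)"

definition partial_sum :: "(nat \<Rightarrow> 'a \<Rightarrow> real) \<Rightarrow> nat \<Rightarrow> 'a \<Rightarrow> real" where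
  "partial_sum X n \<omega> = (\<Sum>i=1..n. X i \<omega>)"

definition V_norm :: "(nat \<Rightarrow> 'a \<Rightarrow> real) \<Rightarrow> nat \<Rightarrow> 'a \<Rightarrow> real" where
  "V_norm X n \<omega> = sqrt (\<Sum>i=1..n. (X i \<omega>)\<^sup>2)"

text \<open>Only meaningful when \<open>V_norm X n \<omega> > exp 1\<close>, so that the iterated logarithm is positive.\<close>

definition v_norm :: "(nat \<Rightarrow> 'a \<Rightarrow> real) \<Rightarrow> nat \<Rightarrow> 'a \<Rightarrow> real" where
  "v_norm X n \<omega> = V_norm X n \<omega> * ln (ln (V_norm X n \<omega>)) powr (-1/2)"

definition h_lam :: "real \<Rightarrow> real" where
  "h_lam l = (THE y. y > 0 \<and> y - ln (1 + y) = l\<^sup>2)"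

definition b_lam :: "real \<Rightarrow> real" where
  "b_lam l = h_lam l / l"

definition gam :: "real \<Rightarrow> real" where
  "gam l = h_lam l / (1 + h_lam l)"

definition C_gam :: "real \<Rightarrow> real" where
  "C_gam g = - (g + ln (1 - g)) / g\<^sup>2"

definition a_lam :: "real \<Rightarrow> real" where
  "a_lam l = l / (gam l * C_gam (gam l))"

lemma h_strict_mono:
  fixes x y :: real
  assumes "0 \<le> x" "x < y"
  shows "x - ln (1 + x) < y - ln (1 + y)"
proof (rule DERIV_pos_imp_increasing_open[OF \<open>x < y\<close>])
  fix t assume "x < t" "t < y"
  then have "((\<lambda>y. y - ln (1 + y)) has_real_derivative (1 - 1 / (1 + t))) (at t)"
    using assms by (auto intro!: derivative_eq_intros)
  moreover have "1 - 1 / (1 + t) > 0"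
    using \<open>x < t\<close> assms by (simp add: field_simps)
  ultimately show "\<exists>z. ((\<lambda>y. y - ln (1 + y)) has_real_derivative z) (at t) \<and> z > 0"
    by blast
next
  show "continuous_on {x..y} (\<lambda>y. y - ln (1 + y))"
    using assms by (auto intro!: continuous_intros)
qed

lemma h_ex1:
  fixes l :: real
  assumes "l > 0"
  shows "\<exists>!y::real. y > 0 \<and> y - ln (1 + y) = l\<^sup>2"
proof -
  have "filterlim (\<lambda>y::real. y - ln (1 + y)) at_top at_top"
    by real_asymp
  then have "eventually (\<lambda>y::real. y - ln (1 + y) \<ge> l\<^sup>2 \<and> y \<ge> 0) at_top"
    by (intro eventually_conj eventually_ge_at_top) (auto simp: filterlim_at_top)
  then obtain z :: real where z: "z - ln (1 + z) \<ge> l\<^sup>2" "z \<ge> 0"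
    by (auto simp: eventually_at_top_linorder)
  have "\<exists>y\<ge>0. y \<le> z \<and> y - ln (1 + y) = l\<^sup>2"
    using z by (intro IVT') (auto intro!: continuous_intros)
  then obtain y where y: "y \<ge> 0" "y - ln (1 + y) = l\<^sup>2"
    by blast
  have "y \<noteq> 0"
    using y assms by auto
  then have "y > 0 \<and> y - ln (1 + y) = l\<^sup>2"
    using y by simp
  moreover have "y' = y" if "y' > 0 \<and> y' - ln (1 + y') = l\<^sup>2" for y'
    using that y h_strict_mono[of y y'] h_strict_mono[of y' y] by (cases y y' rule: linorder_cases) auto
  ultimately show ?thesis
    by blast
qed

end

theory Submission
  imports Defs
begin

text \<open>
  For a fixed truncation \<open>[- c, d)\<close> and \<open>t > 0\<close> with \<open>t * c \<le> g < 1\<close> and \<open>C * t * d \<ge> 1\<close>, where \<open>C \<ge> C_gam g\<close>, the process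
  \<open>exp (t * (S n - (\<Sum>i\<le>n. \<mu> i (- c) d)) - C * t\<^sup>2 * (V n)\<^sup>2)\<close> is a supermartingale. The reason is the inequality
  \<open>exp (y - C_gam g * y\<^sup>2) \<le> 1 + y\<close> for \<open>y \<ge> - g\<close>: values of \<open>X i\<close> inside the truncation are handled by it
  with \<open>y = t * X i\<close>, while outside the exponent \<open>t * X i - C * (t * X i)\<^sup>2\<close> is at most \<open>0\<close>
  (\<open>exp_quadratic_le_truncated\<close>, \<open>nn_integral_exp_step\<close>). The quadratic term is built from \<open>(X i)\<^sup>2\<close> itself
  and not from conditional variances, so large values of \<open>X i\<close> compensate themselves. A maximal inequality bounds by
  \<open>exp (- r)\<close> the probability that the exponent ever reaches \<open>r\<close> (\<open>deviation_inequality\<close>).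

  The truncation levels of the theorem are random and depend on \<open>n\<close>. They are made constant on the blocks
  \<open>\<rho> ^ k \<le> V n < \<rho> ^ (k + 1)\<close>: since \<open>\<mu> i (c, d)\<close> increases in both endpoints as long as \<open>c \<le> 0 \<le> d\<close>,
  replacing \<open>- l * v n\<close> and \<open>a_lam l * v n\<close> by lower bounds valid on the block only increases the centred
  sum. With \<open>t = gam l / (l * D)\<close>, where \<open>D\<close> is an upper bound of \<open>v n\<close> on the block, a centred sum above
  \<open>(1 + \<epsilon>) * b_lam l * V n * sqrt (ln (ln (V n)))\<close> forces the exponent above \<open>q * ln (ln (\<rho> ^ k))\<close>. The
  definitions of \<open>h_lam\<close>, \<open>b_lam\<close>, \<open>gam\<close> and \<open>C_gam\<close> are such that the constant \<open>q\<close> would be exactly \<open>1\<close>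
  for \<open>\<epsilon> = 0\<close> and \<open>\<rho> = 1\<close> (\<open>exponent_constant_eq_1\<close>). For \<open>\<epsilon> > 0\<close> and \<open>\<rho>\<close> close to \<open>1\<close> therefore \<open>q > 1\<close>,
  the probabilities are of order \<open>k powr (- q)\<close>, and the Borel-Cantelli lemma applies
  (\<open>eventually_le_b_lam\<close>). Letting \<open>\<epsilon>\<close> tend to \<open>0\<close> along a sequence gives the bound on the limes superior.

  The limit of \<open>b_lam\<close> at \<open>0\<close> follows from \<open>h - ln (1 + h) \<approx> h\<^sup>2 / 2\<close>, made quantitative on both sides.
\<close>

section \<open>An exponential inequality for one truncated summand\<close>

lemma ln_one_minus_upper_quadratic:
  fixes g :: real
  assumes "0 \<le> g" "g < 1"
  shows "ln (1 - g) \<le> - g - g\<^sup>2 / 2"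
proof -
  let ?f = "\<lambda>x::real. - ln (1 - x) - x - x\<^sup>2 / 2"
  have "?f 0 \<le> ?f g"
  proof (rule DERIV_nonneg_imp_nondecreasing[OF assms(1)])
    fix x assume x: "0 \<le> x" "x \<le> g"
    have "(?f has_real_derivative (1 / (1 - x) - 1 - x)) (at x)"
      using x assms by (auto intro!: derivative_eq_intros simp: field_simps)
    moreover have "1 / (1 - x) - 1 - x = x\<^sup>2 / (1 - x)"
      using x assms by (simp add: field_simps power2_eq_square)
    then have "1 / (1 - x) - 1 - x \<ge> 0"
      using x assms by simp
    ultimately show "\<exists>y. (?f has_real_derivative y) (at x) \<and> y \<ge> 0"
      by blast
  qed
  then show ?thesis by simp
qed

text \<open>
  The bound makes \<open>f'(y) = y (2 C - 1 / (1 + y))\<close> nonnegative for all \<open>y \<ge> 0\<close> in the next proof, and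
  it is where the positivity of \<open>C_gam\<close> comes from.
\<close>

lemma C_gam_ge_half:
  assumes "0 < g" "g < 1"
  shows "C_gam g \<ge> 1 / 2"
  using ln_one_minus_upper_quadratic[of g] assms
  by (simp add: C_gam_def field_simps)

text \<open>
  Let \<open>f y = ln (1 + y) - y + C y\<^sup>2\<close>. Then \<open>C_gam g\<close> is exactly the value of \<open>C\<close> for which
  \<open>f (- g) = 0 = f 0\<close>. Since \<open>f'\<close> changes sign at most once on \<open>[- g, 0]\<close>, from plus to minus, \<open>f\<close> is
  nonnegative there, and it increases on \<open>[0, \<infinity>)\<close>.
\<close>

lemma exp_minus_C_gam_le:
  fixes y g :: real
  assumes g: "0 < g" "g < 1" and y: "- g \<le> y"
  shows "exp (y - C_gam g * y\<^sup>2) \<le> 1 + y"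
proof -
  define C where "C = C_gam g"
  have C: "C \<ge> 1 / 2" using C_gam_ge_half[OF g] by (simp add: C_def)
  define f where "f = (\<lambda>t::real. ln (1 + t) - t + C * t\<^sup>2)"
  define f' where "f' = (\<lambda>t::real. t * (2 * C - 1 / (1 + t)))"
  have D: "(f has_real_derivative f' t) (at t)" if "t \<ge> - g" for t
    unfolding f_def f'_def using that g
    by (auto intro!: derivative_eq_intros simp: field_simps)
  have f0: "f 0 = 0" by (simp add: f_def)
  have fg: "f (- g) = 0" using g by (simp add: f_def C_def C_gam_def field_simps)
  have "f y \<ge> 0"
  proof (cases "y \<ge> 0")
    case True
    have "f 0 \<le> f y"
    proof (rule DERIV_nonneg_imp_nondecreasing[OF True])
      fix t assume t: "0 \<le> t" "t \<le> y"
      have "1 / (1 + t) \<le> 1" using t by simp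
      then have "2 * C - 1 / (1 + t) \<ge> 0" using C by linarith
      then have "f' t \<ge> 0" unfolding f'_def using t by simp
      then show "\<exists>z. (f has_real_derivative z) (at t) \<and> z \<ge> 0"
        using D[of t] t g by auto
    qed
    then show ?thesis using f0 by simp
  next
    case False
    show ?thesis
    proof (cases "2 * C \<ge> 1 / (1 + y)")
      case True
      have "f y \<ge> f 0"
      proof (rule DERIV_nonpos_imp_nonincreasing[of y 0])
        fix t assume t: "y \<le> t" "t \<le> 0"
        have "1 / (1 + t) \<le> 1 / (1 + y)" using t y g by (intro divide_left_mono) auto
        then have "f' t \<le> 0" using t True by (simp add: f'_def mult_nonpos_nonneg)
        then show "\<exists>z. (f has_real_derivative z) (at t) \<and> z \<le> 0"
          using D[of t] t y by auto
      qed (use False in auto)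
      then show ?thesis using f0 by simp
    next
      case F2: False
      have "f (- g) \<le> f y"
      proof (rule DERIV_nonneg_imp_nondecreasing[OF y])
        fix t assume t: "- g \<le> t" "t \<le> y"
        have "1 / (1 + y) \<le> 1 / (1 + t)" using t y g by (intro divide_left_mono) auto
        then have "f' t \<ge> 0" using t F2 False by (simp add: f'_def mult_nonpos_nonpos)
        then show "\<exists>z. (f has_real_derivative z) (at t) \<and> z \<ge> 0"
          using D[of t] t by auto
      qed
      then show ?thesis using fg by simp
    qed
  qed
  then have "y - C * y\<^sup>2 \<le> ln (1 + y)" by (simp add: f_def)
  then have "exp (y - C * y\<^sup>2) \<le> exp (ln (1 + y))" by simp
  also have "\<dots> = 1 + y" using y g by simp
  finally show ?thesis by (simp add: C_def)
qed

text \<open>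
  Only values in \<open>[- c, d)\<close> need a linear term. Below \<open>- c\<close> the exponent is negative because \<open>x\<close> is;
  above \<open>d\<close> it is negative because the quadratic term dominates, and \<open>1 / (C t)\<close> is the point from which
  on it does. This explains the value of \<open>a_lam\<close>: with \<open>t = gam l / (l v)\<close> one gets \<open>1 / (C_gam (gam l) t) = a_lam l * v\<close>.
\<close>

lemma exp_quadratic_le_truncated:
  fixes x g C t c d :: real
  assumes g: "0 < g" "g < 1" and C: "C_gam g \<le> C" and t: "0 < t"
    and c: "0 < c" "t * c \<le> g" and d: "1 \<le> C * t * d"
  shows "exp (t * x - C * t\<^sup>2 * x\<^sup>2) \<le> 1 + t * (indicator {- c..<d} x * x)"
proof -
  have C0: "C > 0" using C C_gam_ge_half[OF g] by simp
  consider "x < - c" | "- c \<le> x" "x < d" | "d \<le> x" "- c \<le> x" by linarith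
  then show ?thesis
  proof cases
    case 1
    then have "t * x \<le> 0" using c t by (simp add: mult_nonneg_nonpos)
    moreover have "0 \<le> C * t\<^sup>2 * x\<^sup>2" using C0 by simp
    ultimately have "t * x - C * t\<^sup>2 * x\<^sup>2 \<le> 0" by linarith
    then show ?thesis using 1 by simp
  next
    case 2
    have "t * (- c) \<le> t * x" using 2 t by (intro mult_left_mono) auto
    then have "- g \<le> t * x" using c by simp
    then have e: "exp (t * x - C_gam g * (t * x)\<^sup>2) \<le> 1 + t * x"
      by (rule exp_minus_C_gam_le[OF g])
    from C have "C_gam g * (t * x)\<^sup>2 \<le> C * (t * x)\<^sup>2"
      by (intro mult_right_mono) auto
    from this have "exp (t * x - C * t\<^sup>2 * x\<^sup>2) \<le> exp (t * x - C_gam g * (t * x)\<^sup>2)"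
      by (simp add: power_mult_distrib mult.assoc)
    with e have "exp (t * x - C * t\<^sup>2 * x\<^sup>2) \<le> 1 + t * x" by linarith
    then show ?thesis using 2 by simp
  next
    case 3
    have dp: "d > 0" using d C0 t by (smt (verit) mult_nonneg_nonpos mult_pos_pos)
    have "C * t * d \<le> C * t * x" using 3 C0 t by (intro mult_left_mono) auto
    then have "1 * (t * x) \<le> (C * t * x) * (t * x)"
      using 3 t d dp by (intro mult_right_mono) auto
    then have "t * x - C * t\<^sup>2 * x\<^sup>2 \<le> 0" by (simp add: power2_eq_square algebra_simps)
    then show ?thesis using 3 by simp
  qed
qed

section \<open>The constants\<close>

text \<open>
  Both bounds agree with \<open>h\<^sup>2 / 2\<close> to second order at \<open>0\<close>. The form of the lower one makes the relation
  \<open>h - ln (1 + h) = l\<^sup>2\<close> yield a quadratic inequality for \<open>h\<close>, so that \<open>h\<close> can be bounded explicitly.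
\<close>

lemma quadratic_bounds_h:
  fixes h :: real
  assumes "0 \<le> h"
  shows "h - ln (1 + h) \<le> h\<^sup>2 / 2" and "h\<^sup>2 / (2 * (1 + h)) \<le> h - ln (1 + h)"
proof -
  let ?f = "\<lambda>x::real. x\<^sup>2 / 2 - x + ln (1 + x)"
  have "?f 0 \<le> ?f h"
  proof (rule DERIV_nonneg_imp_nondecreasing[OF assms(1)])
    fix x assume x: "0 \<le> x" "x \<le> h"
    have "(?f has_real_derivative (x - 1 + 1 / (1 + x))) (at x)"
      using x by (auto intro!: derivative_eq_intros simp: field_simps)
    moreover have "x - 1 + 1 / (1 + x) = x\<^sup>2 / (1 + x)"
      using x by (simp add: field_simps power2_eq_square)
    then have "x - 1 + 1 / (1 + x) \<ge> 0" using x by simp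
    ultimately show "\<exists>y. (?f has_real_derivative y) (at x) \<and> y \<ge> 0" by blast
  qed
  then show "h - ln (1 + h) \<le> h\<^sup>2 / 2" by simp
  let ?g = "\<lambda>x::real. x - ln (1 + x) - (x - 1 + 1 / (1 + x)) / 2"
  have eq: "(x - 1 + 1 / (1 + x)) / 2 = x\<^sup>2 / (2 * (1 + x))" if "x \<ge> 0" for x :: real
    using that by (simp add: field_simps power2_eq_square)
  \<comment> \<open>The derivative of \<open>?g\<close>, with \<open>u = 1 / (1 + x)\<close>.\<close>
  have sq: "1 - u - (1 - u\<^sup>2) / 2 = (1 - u)\<^sup>2 / 2" for u :: real
    by (simp add: power2_diff field_simps)
  have "?g 0 \<le> ?g h"
  proof (rule DERIV_nonneg_imp_nondecreasing[OF assms(1)])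
    fix x assume x: "0 \<le> x" "x \<le> h"
    have "(?g has_real_derivative (1 - 1 / (1 + x) - (1 - (1 / (1 + x))\<^sup>2) / 2)) (at x)"
      by (insert x, (rule derivative_eq_intros refl | simp)+, simp add: power2_eq_square)
    moreover have "1 - 1 / (1 + x) - (1 - (1 / (1 + x))\<^sup>2) / 2 \<ge> 0"
      unfolding sq by simp
    ultimately show "\<exists>y. (?g has_real_derivative y) (at x) \<and> y \<ge> 0" by blast
  qed
  then have "0 \<le> ?g h" by simp
  then show "h\<^sup>2 / (2 * (1 + h)) \<le> h - ln (1 + h)" using eq[OF assms] by linarith
qed

lemma h_lam_pos: "l > 0 \<Longrightarrow> h_lam l > 0"
  and h_lam_eq: "l > 0 \<Longrightarrow> h_lam l - ln (1 + h_lam l) = l\<^sup>2"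
  using theI'[OF h_ex1] unfolding h_lam_def by auto

text \<open>
  The quadratic bounds give \<open>sqrt 2 \<le> b_lam l \<le> l + sqrt (l\<^sup>2 + 2)\<close>; the right-hand side comes from
  completing the square in \<open>h\<^sup>2 \<le> 2 l\<^sup>2 (1 + h)\<close>.
\<close>

lemma b_lam_tendsto: "(b_lam \<longlongrightarrow> sqrt 2) (at_right 0)"
proof (rule tendsto_sandwich)
  have "b_lam l \<ge> sqrt 2" if l: "l > 0" for l
  proof -
    have "2 * l\<^sup>2 \<le> (h_lam l)\<^sup>2"
      using quadratic_bounds_h(1)[of "h_lam l"] h_lam_pos[OF l] h_lam_eq[OF l] by simp
    then have "sqrt (2 * l\<^sup>2) \<le> h_lam l"
      using h_lam_pos[OF l] by (intro real_le_lsqrt) auto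
    then show ?thesis using l by (simp add: b_lam_def real_sqrt_mult field_simps)
  qed
  then show "eventually (\<lambda>l. sqrt 2 \<le> b_lam l) (at_right 0)"
    by (auto simp: eventually_at_right_less intro: eventually_at_rightI[of _ 1])
  have "b_lam l \<le> l + sqrt (l\<^sup>2 + 2)" if l: "l > 0" for l
  proof -
    let ?h = "h_lam l"
    have h: "?h > 0" by (rule h_lam_pos[OF l])
    have "?h\<^sup>2 / (2 * (1 + ?h)) \<le> l\<^sup>2"
      using quadratic_bounds_h(2)[of ?h] h h_lam_eq[OF l] by simp
    then have "?h\<^sup>2 \<le> l\<^sup>2 * (2 * (1 + ?h))" using h by (simp add: pos_divide_le_eq)
    then have "(?h - l\<^sup>2)\<^sup>2 \<le> l\<^sup>2 * (l\<^sup>2 + 2)"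
      by (simp add: power2_eq_square algebra_simps)
    then have "?h - l\<^sup>2 \<le> sqrt (l\<^sup>2 * (l\<^sup>2 + 2))" by (rule real_le_rsqrt)
    also have "\<dots> = l * sqrt (l\<^sup>2 + 2)" using l by (simp add: real_sqrt_mult)
    finally show ?thesis using l by (simp add: b_lam_def field_simps power2_eq_square)
  qed
  then show "eventually (\<lambda>l. b_lam l \<le> l + sqrt (l\<^sup>2 + 2)) (at_right 0)"
    by (auto intro: eventually_at_rightI[of _ 1])
  have "((\<lambda>l::real. l + sqrt (l\<^sup>2 + 2)) \<longlongrightarrow> 0 + sqrt (0\<^sup>2 + 2)) (at_right 0)"
    by (intro tendsto_intros)
  then show "((\<lambda>l::real. l + sqrt (l\<^sup>2 + 2)) \<longlongrightarrow> sqrt 2) (at_right 0)" by simp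
qed simp

lemma gam_bounds: "l > 0 \<Longrightarrow> 0 < gam l" "l > 0 \<Longrightarrow> gam l < 1"
  using h_lam_pos[of l] by (auto simp: gam_def)

text \<open>
  This identity is the reason for the equation that defines \<open>h_lam\<close>. If \<open>t = gam l / (l v)\<close> and the
  centred sum is \<open>b_lam l * V * sqrt (ln (ln V))\<close>, then the exponent of the supermartingale is
  \<open>ln (ln V)\<close> times the left-hand side, and the value \<open>1\<close> is the border of summability of
  \<open>exp (- q * ln (ln (\<rho> ^ k)))\<close> over \<open>k\<close>.
\<close>

lemma exponent_constant_eq_1:
  assumes l: "l > 0"
  shows "b_lam l * gam l / l - C_gam (gam l) * (gam l)\<^sup>2 / l\<^sup>2 = 1"
proof -
  let ?h = "h_lam l" let ?g = "gam l"
  have h: "?h > 0" by (rule h_lam_pos[OF l])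
  have "1 - ?g = 1 / (1 + ?h)" using h by (simp add: gam_def field_simps)
  then have ln: "ln (1 - ?g) = - ln (1 + ?h)" using h by (simp add: ln_div)
  have "(1 + ?h) * ?g = ?h" using h by (simp add: gam_def)
  then have hg: "?h * ?g + ?g = ?h" by (simp add: algebra_simps)
  have "C_gam ?g * ?g\<^sup>2 = - (?g - ln (1 + ?h))"
    using gam_bounds(1)[OF l] by (simp add: C_gam_def ln)
  then have "b_lam l * ?g / l - C_gam ?g * ?g\<^sup>2 / l\<^sup>2 = (?h * ?g + (?g - ln (1 + ?h))) / l\<^sup>2"
    using l by (simp add: b_lam_def power2_eq_square add_divide_distrib diff_divide_distrib)
  also have "\<dots> = l\<^sup>2 / l\<^sup>2" using hg h_lam_eq[OF l] by (metis add_diff_eq)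
  finally show ?thesis using l by simp
qed

section \<open>Geometric blocks\<close>

text \<open>
  The bracket below is the exponent constant after the losses caused by treating all \<open>V\<close> in one block
  \<open>[\<rho> ^ k, \<rho> ^ (k + 1))\<close> alike. It tends to \<open>1 + \<epsilon> A\<close> as \<open>\<rho>\<close> decreases to \<open>1\<close>, so a fine enough grid
  keeps it above \<open>1\<close>.
\<close>

lemma exists_grid_ratio:
  fixes A B \<epsilon> :: real
  assumes "A - B = 1" "A > 0" "\<epsilon> > 0"
  shows "\<exists>\<rho>>1. (1 + \<epsilon>) * A / \<rho> - \<rho>\<^sup>2 * B > 1 + \<epsilon> * A / 2"
proof -
  have "((\<lambda>\<rho>. (1 + \<epsilon>) * A / \<rho> - \<rho>\<^sup>2 * B) \<longlongrightarrow> (1 + \<epsilon>) * A / 1 - 1\<^sup>2 * B) (at_right 1)"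
    by (intro tendsto_intros) auto
  moreover have "(1 + \<epsilon>) * A / 1 - 1\<^sup>2 * B > 1 + \<epsilon> * A / 2"
    using assms(1) mult_pos_pos[OF assms(3,2)] by (simp add: distrib_right)
  ultimately have "eventually (\<lambda>\<rho>. (1 + \<epsilon>) * A / \<rho> - \<rho>\<^sup>2 * B > 1 + \<epsilon> * A / 2) (at_right 1)"
    by (rule order_tendstoD(1))
  then have "eventually (\<lambda>\<rho>. \<rho> > 1 \<and> (1 + \<epsilon>) * A / \<rho> - \<rho>\<^sup>2 * B > 1 + \<epsilon> * A / 2) (at_right 1)"
    by (rule eventually_conj[OF eventually_at_right_less])
  then show ?thesis
    using eventually_happens'[OF trivial_limit_at_right_real] by blast
qed

lemma loglog_grid_eventually:
  fixes u \<rho> :: real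
  assumes u: "u > 0" and \<rho>: "\<rho> > 1"
  shows "eventually (\<lambda>k::nat. 0 < ln (real k * u) \<and> ln (real (Suc k) * u) \<le> \<rho>\<^sup>2 * ln (real k * u)) sequentially"
proof -
  have "filterlim (\<lambda>k. ln (real k * u)) at_top sequentially" using u by real_asymp
  then have "eventually (\<lambda>k. ln (real k * u) > 0) sequentially"
    by (auto simp: filterlim_at_top_dense)
  moreover have "(\<lambda>k. ln (real (Suc k) * u) / ln (real k * u)) \<longlonglongrightarrow> 1"
    using u by real_asymp
  then have "eventually (\<lambda>k. ln (real (Suc k) * u) / ln (real k * u) < \<rho>\<^sup>2) sequentially"
    using \<rho> by (intro order_tendstoD(2)) (auto simp: one_less_power)
  ultimately show ?thesis
    by eventually_elim (auto simp: pos_divide_less_eq)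
qed

text \<open>
  The terms are constant multiples of \<open>k powr (- q)\<close>, because \<open>ln (ln (\<rho> ^ k))\<close> is \<open>ln (k * u)\<close>
  with \<open>u = ln \<rho>\<close>.
\<close>

lemma summable_exp_loglog_grid:
  fixes u q :: real
  assumes "u > 0" "q > 1"
  shows "summable (\<lambda>k. exp (- (q * ln (real k * u))))"
proof -
  have "summable (\<lambda>k. u powr (- q) * real k powr (- q))"
    using assms by (intro summable_mult) (simp add: summable_real_powr_iff)
  moreover have "eventually (\<lambda>k. exp (- (q * ln (real k * u))) = u powr (- q) * real k powr (- q)) sequentially"
    using eventually_gt_at_top[of 0]
  proof eventually_elim
    case (elim k)
    then show ?case using assms by (simp add: powr_def ln_mult exp_add[symmetric] ring_distribs)
  qed
  ultimately show ?thesis by (simp add: summable_cong)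
qed

lemma exists_geometric_block:
  fixes \<rho> V :: real
  assumes \<rho>: "\<rho> > 1" and V: "\<rho> ^ j \<le> V"
  shows "\<exists>k\<ge>j. \<rho> ^ k \<le> V \<and> V < \<rho> ^ Suc k"
proof -
  obtain m where "V < \<rho> ^ m" using real_arch_pow[OF \<rho>] by blast
  then show ?thesis
  proof (induction m)
    case 0
    have "1 \<le> \<rho> ^ j" using \<rho> by (intro one_le_power) simp
    then show ?case using 0 V by simp
  next
    case (Suc m)
    show ?case
    proof (cases "\<rho> ^ m \<le> V")
      case True
      have "\<rho> ^ j < \<rho> ^ Suc m" using V Suc.prems by linarith
      then have "j < Suc m" using power_less_imp_less_exp[OF \<rho>] by blast
      then show ?thesis using True Suc.prems by (intro exI[of _ m]) simp
    next
      case False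
      then show ?thesis using Suc.IH by simp
    qed
  qed
qed

lemma loglog_in_block:
  fixes \<rho> V :: real and k :: nat
  assumes \<rho>: "\<rho> > 1" and V: "\<rho> ^ k \<le> V" "V < \<rho> ^ Suc k" and k: "k > 0"
  shows "ln (real k * ln \<rho>) \<le> ln (ln V)" "ln (ln V) \<le> ln (real (Suc k) * ln \<rho>)"
proof -
  have pow: "\<rho> ^ i > 0" for i using \<rho> by simp
  have V0: "V > 0" using V(1) pow[of k] by linarith
  have lnpow: "ln (\<rho> ^ i) = real i * ln \<rho>" for i using \<rho> by (simp add: ln_realpow)
  have "ln (\<rho> ^ k) \<le> ln V" using V(1) V0 pow by (intro ln_mono) auto
  then have low: "real k * ln \<rho> \<le> ln V" unfolding lnpow .
  have "ln V \<le> ln (\<rho> ^ Suc k)" using V(2) V0 by (intro ln_mono) auto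
  then have up: "ln V \<le> real (Suc k) * ln \<rho>" unfolding lnpow .
  have pos: "0 < real k * ln \<rho>" using k \<rho> by simp
  show "ln (real k * ln \<rho>) \<le> ln (ln V)" using low pos by (intro ln_mono) auto
  show "ln (ln V) \<le> ln (real (Suc k) * ln \<rho>)" using low up pos by (intro ln_mono) auto
qed

text \<open>
  As \<open>V\<close> runs through a block, \<open>V / sqrt (ln (ln V))\<close> stays between two numbers of ratio \<open>\<rho>\<^sup>2\<close> that do
  not depend on \<open>V\<close>; they will be the truncation levels used for the whole block.
\<close>

lemma normalizer_in_block:
  fixes \<rho> V L LV e :: real
  assumes \<rho>: "\<rho> > 1" and e: "0 < e" "e \<le> V" "V \<le> \<rho> * e"
    and L: "0 < L" "L \<le> LV" "LV \<le> \<rho>\<^sup>2 * L"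
  shows "V / sqrt LV \<le> \<rho> * e / sqrt L" "\<rho> * e / sqrt L / \<rho>\<^sup>2 \<le> V / sqrt LV"
proof -
  show "V / sqrt LV \<le> \<rho> * e / sqrt L" using assms by (intro frac_le) auto
  have "sqrt LV \<le> sqrt (\<rho>\<^sup>2 * L)" using L by simp
  also have "\<dots> = \<rho> * sqrt L" using \<rho> by (simp add: real_sqrt_mult)
  finally have "e / (\<rho> * sqrt L) \<le> V / sqrt LV" using assms by (intro frac_le) auto
  moreover have "\<rho> * e / sqrt L / \<rho>\<^sup>2 = e / (\<rho> * sqrt L)"
    using \<rho> by (simp add: power2_eq_square)
  ultimately show "\<rho> * e / sqrt L / \<rho>\<^sup>2 \<le> V / sqrt LV" by simp
qed

text \<open>
  The lower bound uses the smallest possible deviation and the largest possible \<open>V\<close> in the block. The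
  extra factor \<open>\<rho>\<^sup>2\<close> at \<open>C\<close> pays for the difference between the two bounds of \<open>normalizer_in_block\<close>: the
  lower truncation level, and with it \<open>t\<close>, comes from the upper bound, the upper truncation level from
  the lower bound.
\<close>

lemma exponent_in_block:
  fixes S b g l C \<rho> \<epsilon> L LV V e t :: real
  assumes pos: "0 < b" "0 < g" "0 < l" "0 < C" "0 < \<epsilon>"
    and \<rho>: "\<rho> > 1" and e: "0 < e" "e \<le> V" "V \<le> \<rho> * e"
    and L: "0 < L" "L \<le> LV"
    and S: "(1 + \<epsilon>) * b * (V * sqrt LV) \<le> S"
    and t: "t = g / (l * (\<rho> * e / sqrt L))"
  shows "((1 + \<epsilon>) * (b * g / l) / \<rho> - \<rho>\<^sup>2 * (C * g\<^sup>2 / l\<^sup>2)) * L \<le> t * S - C * \<rho>\<^sup>2 * t\<^sup>2 * V\<^sup>2"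
proof -
  have tpos: "t > 0" using pos \<rho> e L unfolding t by simp
  have tk: "t = g * sqrt L / (l * \<rho> * e)" by (simp add: t)
  have "(1 + \<epsilon>) * b * (e * sqrt L) \<le> (1 + \<epsilon>) * b * (V * sqrt LV)"
    using pos e L by (intro mult_left_mono mult_mono) auto
  then have "t * ((1 + \<epsilon>) * b * (e * sqrt L)) \<le> t * S"
    using tpos S by (intro mult_left_mono) auto
  moreover have "t * ((1 + \<epsilon>) * b * (e * sqrt L)) = (1 + \<epsilon>) * (b * g / l) / \<rho> * L"
  proof -
    have "t * ((1 + \<epsilon>) * b * (e * sqrt L)) = (1 + \<epsilon>) * b * g * (sqrt L * sqrt L) / (l * \<rho>)"
      using e by (simp add: tk)
    also have "\<dots> = (1 + \<epsilon>) * (b * g / l) / \<rho> * L"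
      using L by (simp add: real_sqrt_mult_self)
    finally show ?thesis .
  qed
  moreover have "C * \<rho>\<^sup>2 * t\<^sup>2 * V\<^sup>2 \<le> C * \<rho>\<^sup>2 * t\<^sup>2 * (\<rho> * e)\<^sup>2"
    using e pos by (intro mult_left_mono power_mono) auto
  moreover have "C * \<rho>\<^sup>2 * t\<^sup>2 * (\<rho> * e)\<^sup>2 = \<rho>\<^sup>2 * (C * g\<^sup>2 / l\<^sup>2) * L"
    using \<rho> e L by (simp add: tk power_mult_distrib power_divide)
  ultimately show ?thesis by (simp add: left_diff_distrib)
qed

section \<open>Integration against a regular conditional distribution\<close>

text \<open>
  The definition of \<open>regular_cond_distr\<close> gives this for indicators \<open>f\<close>, where the exceptional null set
  may depend on the Borel set. After integration the null sets do no harm, and the identity extends to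
  all nonnegative Borel functions by linearity and monotone convergence.
\<close>

lemma nn_integral_regular_cond_distr:
  assumes "prob_space M" and sub: "subalgebra M G" and Y: "Y \<in> borel_measurable M"
    and K: "regular_cond_distr M G Y K"
    and g: "g \<in> borel_measurable G" and f: "f \<in> borel_measurable borel"
  shows "(\<integral>\<^sup>+\<omega>. g \<omega> * f (Y \<omega>) \<partial>M) = (\<integral>\<^sup>+\<omega>. g \<omega> * (\<integral>\<^sup>+y. f y \<partial>K \<omega>) \<partial>M)"
proof -
  interpret prob_space M by fact
  interpret finite_measure_subalgebra M G by unfold_locales (rule sub)
  have K': "K \<in> measurable G (prob_algebra borel)" using K by (simp add: regular_cond_distr_def)
  have sK: "sets (K \<omega>) = sets borel" "prob_space (K \<omega>)" if "\<omega> \<in> space M" for \<omega>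
    using measurable_space[OF K'] that sub by (auto simp: space_prob_algebra subalgebra_def)
  have g'[measurable]: "g \<in> borel_measurable M" by (rule measurable_from_subalg[OF sub g])
  have Km[measurable]: "K \<in> measurable M (subprob_algebra borel)"
    using measurable_prob_algebraD[OF K'] by (rule measurable_from_subalg[OF sub])
  note [measurable] = Y
  have int_m: "(\<lambda>\<omega>. \<integral>\<^sup>+y. u y \<partial>K \<omega>) \<in> borel_measurable M"
    if "u \<in> borel_measurable borel" for u
    using measurable_compose[OF Km nn_integral_measurable_subprob_algebra[OF that]] .
  from f show ?thesis
  proof (induction f rule: borel_measurable_induct)
    case (cong u v)
    have "u = v" using cong.hyps(3) by auto
    then show ?case using cong.IH by simp
  next
    case (set B)
    have B: "Y -` B \<inter> space M \<in> sets M" using set by measurable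
    have I[measurable]: "(\<lambda>\<omega>. ennreal (indicator (Y -` B \<inter> space M) \<omega>)) \<in> borel_measurable M"
      by (intro measurable_compose[OF borel_measurable_indicator[OF B]]) simp
    have 1: "(\<integral>\<^sup>+\<omega>. g \<omega> * indicator B (Y \<omega>) \<partial>M)
      = (\<integral>\<^sup>+\<omega>. g \<omega> * ennreal (indicator (Y -` B \<inter> space M) \<omega>) \<partial>M)"
      by (intro nn_integral_cong) (auto simp: indicator_def)
    have 2: "\<dots> = (\<integral>\<^sup>+\<omega>. g \<omega> * nn_cond_exp M G (\<lambda>\<omega>. ennreal (indicator (Y -` B \<inter> space M) \<omega>)) \<omega> \<partial>M)"
      by (intro nn_cond_exp_intg[symmetric] g I)
    have 3: "AE \<omega> in M. nn_cond_exp M G (\<lambda>\<omega>. ennreal (indicator (Y -` B \<inter> space M) \<omega>)) \<omega>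
       = ennreal (real_cond_exp M G (indicator (Y -` B \<inter> space M)) \<omega>)"
    proof -
      have "AE \<omega> in M. nn_cond_exp M G (\<lambda>\<omega>. ennreal (indicator (Y -` B \<inter> space M) \<omega>)) \<omega>
          \<le> nn_cond_exp M G (\<lambda>_. 1) \<omega>"
        by (intro nn_cond_exp_mono AE_I2 I) (auto simp: indicator_def)
      moreover have "AE \<omega> in M. 1 = nn_cond_exp M G (\<lambda>_. 1) \<omega>"
        by (rule nn_cond_exp_F_meas) simp
      moreover have "AE \<omega> in M. 0 = nn_cond_exp M G (\<lambda>_. 0) \<omega>"
        by (rule nn_cond_exp_F_meas) simp
      ultimately show ?thesis
      proof eventually_elim
        case (elim \<omega>)
        have "(\<lambda>x. ennreal (- indicator (Y -` B \<inter> space M) x)) = (\<lambda>_. 0)"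
          by (auto simp: fun_eq_iff indicator_def ennreal_neg)
        then show ?case
          using elim by (auto simp: real_cond_exp_def ennreal_enn2real_if top_unique)
      qed
    qed
    have 4: "AE \<omega> in M. measure (K \<omega>) B = real_cond_exp M G (indicator (Y -` B \<inter> space M)) \<omega>"
      using K set by (simp add: regular_cond_distr_def)
    have "(\<integral>\<^sup>+\<omega>. g \<omega> * nn_cond_exp M G (\<lambda>\<omega>. ennreal (indicator (Y -` B \<inter> space M) \<omega>)) \<omega> \<partial>M)
      = (\<integral>\<^sup>+\<omega>. g \<omega> * (\<integral>\<^sup>+y. indicator B y \<partial>K \<omega>) \<partial>M)"
    proof (rule nn_integral_cong_AE, use 3 4 AE_space in eventually_elim)
      case (elim \<omega>)
      then interpret K: prob_space "K \<omega>" using sK by simp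
      show ?case using elim sK set K.emeasure_eq_measure by simp
    qed
    then show ?case using 1 2 by simp
  next
    case (mult u c)
    have "(\<integral>\<^sup>+\<omega>. g \<omega> * (c * u (Y \<omega>)) \<partial>M) = c * (\<integral>\<^sup>+\<omega>. g \<omega> * u (Y \<omega>) \<partial>M)"
      using mult.hyps by (subst nn_integral_cmult[symmetric]) (auto simp: ac_simps)
    also have "\<dots> = (\<integral>\<^sup>+\<omega>. g \<omega> * (c * (\<integral>\<^sup>+y. u y \<partial>K \<omega>)) \<partial>M)"
      unfolding mult.IH using int_m[OF mult.hyps(2)]
      by (subst nn_integral_cmult[symmetric]) (auto simp: ac_simps)
    also have "\<dots> = (\<integral>\<^sup>+\<omega>. g \<omega> * (\<integral>\<^sup>+y. c * u y \<partial>K \<omega>) \<partial>M)"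
      using mult.hyps sK by (intro nn_integral_cong) (auto simp: nn_integral_cmult cong: measurable_cong_sets)
    finally show ?case .
  next
    case (add u v)
    have "(\<integral>\<^sup>+\<omega>. g \<omega> * (v (Y \<omega>) + u (Y \<omega>)) \<partial>M)
      = (\<integral>\<^sup>+\<omega>. g \<omega> * v (Y \<omega>) \<partial>M) + (\<integral>\<^sup>+\<omega>. g \<omega> * u (Y \<omega>) \<partial>M)"
      using add.hyps by (subst nn_integral_add[symmetric]) (auto simp: distrib_left)
    also have "\<dots> = (\<integral>\<^sup>+\<omega>. g \<omega> * ((\<integral>\<^sup>+y. v y \<partial>K \<omega>) + (\<integral>\<^sup>+y. u y \<partial>K \<omega>)) \<partial>M)"
      unfolding add.IH using int_m[OF add.hyps(1)] int_m[OF add.hyps(3)]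
      by (subst nn_integral_add[symmetric]) (auto simp: distrib_left)
    also have "\<dots> = (\<integral>\<^sup>+\<omega>. g \<omega> * (\<integral>\<^sup>+y. v y + u y \<partial>K \<omega>) \<partial>M)"
      using add.hyps sK by (intro nn_integral_cong) (auto simp: nn_integral_add cong: measurable_cong_sets)
    finally show ?case .
  next
    case (seq U)
    have inc: "incseq U" by fact
    have "(\<integral>\<^sup>+\<omega>. g \<omega> * (SUP i. U i) (Y \<omega>) \<partial>M) = (SUP i. \<integral>\<^sup>+\<omega>. g \<omega> * U i (Y \<omega>) \<partial>M)"
      using seq.hyps(1) inc unfolding SUP_apply SUP_mult_left_ennreal
      by (intro nn_integral_monotone_convergence_SUP) (auto simp: incseq_def le_fun_def intro!: mult_left_mono)
    also have "\<dots> = (SUP i. \<integral>\<^sup>+\<omega>. g \<omega> * (\<integral>\<^sup>+y. U i y \<partial>K \<omega>) \<partial>M)"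
      using seq.IH by simp
    also have "\<dots> = (\<integral>\<^sup>+\<omega>. g \<omega> * (SUP i. \<integral>\<^sup>+y. U i y \<partial>K \<omega>) \<partial>M)"
      using int_m[OF seq.hyps(1)] inc unfolding SUP_mult_left_ennreal
      by (intro nn_integral_monotone_convergence_SUP[symmetric])
         (auto simp: incseq_def le_fun_def intro!: mult_left_mono nn_integral_mono)
    also have "\<dots> = (\<integral>\<^sup>+\<omega>. g \<omega> * (\<integral>\<^sup>+y. (SUP i. U i) y \<partial>K \<omega>) \<partial>M)"
      using seq.hyps(1) inc sK unfolding SUP_apply
      by (intro nn_integral_cong arg_cong2[where f="(*)"] refl nn_integral_monotone_convergence_SUP[symmetric])
         (auto cong: measurable_cong_sets)
    finally show ?case .
  qed
qed

lemma integrable_truncation: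
  assumes "prob_space P" "sets P = sets borel"
  shows "integrable P (\<lambda>y::real. indicator {c..<d} y * y)"
proof -
  interpret prob_space P by fact
  have [measurable_cong]: "sets P = sets borel" by fact
  show ?thesis
    by (rule integrable_const_bound[where B = "\<bar>c\<bar> + \<bar>d\<bar>"]) (auto simp: indicator_def)
qed

text \<open>
  Moving the negative endpoint up discards negative values, and moving the positive endpoint up adds
  positive ones. Hence the random truncation levels of a whole block can be replaced by one pair of
  constants, at the cost of an inequality in the harmless direction.
\<close>

lemma cond_trunc_mean_mono:
  assumes "prob_space (K \<omega>)" "sets (K \<omega>) = sets borel"
    and "c \<le> c'" "c' \<le> 0" "0 \<le> d" "d \<le> d'"
  shows "cond_trunc_mean K c d \<omega> \<le> cond_trunc_mean K c' d' \<omega>"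
  unfolding cond_trunc_mean_def set_lebesgue_integral_def real_scaleR_def
  using assms(3-6)
  by (intro integral_mono integrable_truncation assms(1,2)) (auto simp: indicator_def)

lemma cond_trunc_mean_measurable:
  assumes "K \<in> measurable G (prob_algebra borel)"
  shows "cond_trunc_mean K c d \<in> borel_measurable G"
  unfolding cond_trunc_mean_def set_lebesgue_integral_def
  by (rule measurable_compose[OF measurable_prob_algebraD[OF assms] integral_measurable_subprob_algebra]) measurable

section \<open>One step of the exponential supermartingale\<close>

text \<open>
  The supermartingale property, with the conditional expectation expressed by a test function \<open>Z\<close>. By
  the pointwise inequality the factor is at most \<open>(1 + t Y') exp (- t m)\<close>, where \<open>Y'\<close> is the truncated
  variable and \<open>m\<close> its conditional mean; the conditional mean of this bound is
  \<open>(1 + t m) exp (- t m) \<le> 1\<close>.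
\<close>

lemma nn_integral_exp_step:
  fixes g C t c d :: real and Z :: "'a \<Rightarrow> ennreal"
  assumes "prob_space M" and sub: "subalgebra M G" and Y: "Y \<in> borel_measurable M"
    and K: "regular_cond_distr M G Y K" and Z: "Z \<in> borel_measurable G"
    and g: "0 < g" "g < 1" and C: "C_gam g \<le> C" and t: "0 < t"
    and c: "0 < c" "t * c \<le> g" and d: "1 \<le> C * t * d"
  shows "(\<integral>\<^sup>+\<omega>. Z \<omega> * ennreal (exp (t * (Y \<omega> - cond_trunc_mean K (- c) d \<omega>) - C * t\<^sup>2 * (Y \<omega>)\<^sup>2)) \<partial>M)
    \<le> (\<integral>\<^sup>+\<omega>. Z \<omega> \<partial>M)"
proof -
  define m where "m = cond_trunc_mean K (- c) d"
  define f where "f = (\<lambda>y::real. 1 + t * (indicator {- c..<d} y * y))"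
  have K': "K \<in> measurable G (prob_algebra borel)" using K by (simp add: regular_cond_distr_def)
  have sK: "sets (K \<omega>) = sets borel" "prob_space (K \<omega>)" if "\<omega> \<in> space M" for \<omega>
    using measurable_space[OF K'] that sub by (auto simp: space_prob_algebra subalgebra_def)
  have [measurable]: "m \<in> borel_measurable G"
    unfolding m_def by (rule cond_trunc_mean_measurable[OF K'])
  have f0: "f y \<ge> 0" for y
    using exp_quadratic_le_truncated[OF g C t c d, of y] unfolding f_def
    by (meson exp_ge_zero order_trans)
  have intf: "(\<integral>\<^sup>+y. ennreal (f y) \<partial>K \<omega>) = ennreal (1 + t * m \<omega>)" if "\<omega> \<in> space M" for \<omega>
  proof -
    interpret P: prob_space "K \<omega>" using sK that by simp
    note int = integrable_truncation[OF sK(2)[OF that] sK(1)[OF that], of "- c" d]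
    have "(\<integral>\<^sup>+y. ennreal (f y) \<partial>K \<omega>) = ennreal (\<integral>y. f y \<partial>K \<omega>)"
      using int f0 by (intro nn_integral_eq_integral) (auto simp: f_def)
    also have "(\<integral>y. f y \<partial>K \<omega>) = 1 + t * m \<omega>"
      using int by (simp add: f_def m_def cond_trunc_mean_def set_lebesgue_integral_def P.prob_space)
    finally show ?thesis .
  qed
  have "(\<integral>\<^sup>+\<omega>. Z \<omega> * ennreal (exp (t * (Y \<omega> - m \<omega>) - C * t\<^sup>2 * (Y \<omega>)\<^sup>2)) \<partial>M)
    \<le> (\<integral>\<^sup>+\<omega>. (Z \<omega> * ennreal (exp (- t * m \<omega>))) * ennreal (f (Y \<omega>)) \<partial>M)"
  proof (intro nn_integral_mono)
    fix \<omega>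
    have "exp (t * (Y \<omega> - m \<omega>) - C * t\<^sup>2 * (Y \<omega>)\<^sup>2)
      = exp (- t * m \<omega>) * exp (t * Y \<omega> - C * t\<^sup>2 * (Y \<omega>)\<^sup>2)"
      by (simp add: exp_add[symmetric] algebra_simps)
    also have "\<dots> \<le> exp (- t * m \<omega>) * f (Y \<omega>)"
      unfolding f_def by (intro mult_left_mono exp_quadratic_le_truncated[OF g C t c d]) simp
    finally have "ennreal (exp (t * (Y \<omega> - m \<omega>) - C * t\<^sup>2 * (Y \<omega>)\<^sup>2))
      \<le> ennreal (exp (- t * m \<omega>)) * ennreal (f (Y \<omega>))"
      using f0 by (simp add: ennreal_mult[symmetric] ennreal_leI)
    then show "Z \<omega> * ennreal (exp (t * (Y \<omega> - m \<omega>) - C * t\<^sup>2 * (Y \<omega>)\<^sup>2))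
      \<le> (Z \<omega> * ennreal (exp (- t * m \<omega>))) * ennreal (f (Y \<omega>))"
      by (simp add: mult.assoc mult_left_mono)
  qed
  also have "\<dots> = (\<integral>\<^sup>+\<omega>. (Z \<omega> * ennreal (exp (- t * m \<omega>))) * (\<integral>\<^sup>+y. ennreal (f y) \<partial>K \<omega>) \<partial>M)"
  proof (rule nn_integral_regular_cond_distr[OF assms(1) sub Y K])
    show "(\<lambda>\<omega>. Z \<omega> * ennreal (exp (- t * m \<omega>))) \<in> borel_measurable G"
      using Z by measurable
    show "(\<lambda>y. ennreal (f y)) \<in> borel_measurable borel" unfolding f_def by measurable
  qed
  also have "\<dots> \<le> (\<integral>\<^sup>+\<omega>. Z \<omega> \<partial>M)"
  proof (intro nn_integral_mono)
    fix \<omega> assume w: "\<omega> \<in> space M"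
    have "exp (- t * m \<omega>) * (1 + t * m \<omega>) \<le> exp (- t * m \<omega>) * exp (t * m \<omega>)"
      by (intro mult_left_mono) auto
    also have "\<dots> = 1" by (simp add: exp_add[symmetric])
    finally have "ennreal (exp (- t * m \<omega>)) * ennreal (1 + t * m \<omega>) \<le> 1"
      by (simp add: ennreal_mult'[symmetric] ennreal_le_1)
    then show "(Z \<omega> * ennreal (exp (- t * m \<omega>))) * (\<integral>\<^sup>+y. ennreal (f y) \<partial>K \<omega>) \<le> Z \<omega>"
      using mult_left_mono[of _ 1 "Z \<omega>"] by (simp add: intf[OF w] mult.assoc)
  qed
  finally show ?thesis by (simp add: m_def)
qed

section \<open>A maximal inequality for nonnegative supermartingales\<close>

text \<open>
  The product of the factors \<open>W i\<close>, stopped when it first reaches the level \<open>a\<close>. Asking the stopped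
  process itself whether the level is reached avoids stopping times.
\<close>

primrec stopped_prod :: "ennreal \<Rightarrow> (nat \<Rightarrow> 'a \<Rightarrow> ennreal) \<Rightarrow> nat \<Rightarrow> 'a \<Rightarrow> ennreal" where
  "stopped_prod a W 0 \<omega> = 1"
| "stopped_prod a W (Suc n) \<omega> =
     stopped_prod a W n \<omega> * (if a \<le> stopped_prod a W n \<omega> then 1 else W (Suc n) \<omega>)"

lemma stopped_prod_cases:
  "if \<exists>m\<le>n. a \<le> (\<Prod>i=1..m. W i \<omega>) then a \<le> stopped_prod a W n \<omega>
   else stopped_prod a W n \<omega> = (\<Prod>i=1..n. W i \<omega>)"
proof (induction n)
  case (Suc n)
  have "(\<Prod>i=1..Suc n. W i \<omega>) = (\<Prod>i=1..n. W i \<omega>) * W (Suc n) \<omega>" by simp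
  then show ?case using Suc le_Suc_eq by (auto split: if_splits)
qed simp

text \<open>
  The stopped product is again a supermartingale started at \<open>1\<close>, hence has integral at most \<open>1\<close>, and it
  is at least \<open>a\<close> wherever the product has reached \<open>a\<close>; Markov's inequality and continuity from below
  finish the proof.
\<close>

lemma maximal_inequality:
  fixes W :: "nat \<Rightarrow> 'a \<Rightarrow> ennreal"
  assumes "prob_space M" and sub: "\<And>n. subalgebra M (F n)" and filt: "filtration (space M) F"
    and W: "\<And>n. n \<ge> 1 \<Longrightarrow> W n \<in> borel_measurable (F n)"
    and step: "\<And>n Z. n \<ge> 1 \<Longrightarrow> Z \<in> borel_measurable (F (n - 1)) \<Longrightarrow>
      (\<integral>\<^sup>+\<omega>. Z \<omega> * W n \<omega> \<partial>M) \<le> (\<integral>\<^sup>+\<omega>. Z \<omega> \<partial>M)"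
    and a: "a > 0"
  shows "measure M {\<omega>\<in>space M. \<exists>n. ennreal a \<le> (\<Prod>i=1..n. W i \<omega>)} \<le> 1 / a"
    and "{\<omega>\<in>space M. \<exists>n. ennreal a \<le> (\<Prod>i=1..n. W i \<omega>)} \<in> sets M"
proof -
  interpret prob_space M by fact
  let ?T = "stopped_prod (ennreal a) W"
  define E where "E = (\<lambda>N. {\<omega>\<in>space M. \<exists>n\<le>N. ennreal a \<le> (\<Prod>i=1..n. W i \<omega>)})"
  have mono: "sets (F m) \<subseteq> sets (F n)" "space (F n) = space M" if "m \<le> n" for m n
    using filt that unfolding filtration_def by auto
  have lift: "f \<in> borel_measurable (F n)" if "f \<in> borel_measurable (F m)" "m \<le> n"
    for f :: "'a \<Rightarrow> ennreal" and m n
    using that mono[of m n] mono[of m m] by (auto simp: measurable_def)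
  have T: "?T n \<in> borel_measurable (F n)" for n
  proof (induction n)
    case (Suc n)
    have "?T n \<in> borel_measurable (F (Suc n))" using Suc by (rule lift) simp
    then show ?case using W[of "Suc n"] by simp
  qed simp
  have TM[measurable]: "?T n \<in> borel_measurable M" for n
    by (rule measurable_from_subalg[OF sub T])
  have WM[measurable]: "W n \<in> borel_measurable M" if "n \<ge> 1" for n
    by (rule measurable_from_subalg[OF sub W[OF that]])
  have E_sets: "E N \<in> sets M" for N unfolding E_def by measurable
  have int: "(\<integral>\<^sup>+\<omega>. ?T n \<omega> \<partial>M) \<le> 1" for n
  proof (induction n)
    case 0 then show ?case by (simp add: emeasure_space_1)
  next
    case (Suc n)
    let ?A = "\<lambda>\<omega>. ennreal a \<le> ?T n \<omega>"
    \<comment> \<open>Where the level is already reached nothing changes; elsewhere the factor is tested against the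
      function that vanishes on the stopped part.\<close>
    have "(\<integral>\<^sup>+\<omega>. ?T (Suc n) \<omega> \<partial>M)
      = (\<integral>\<^sup>+\<omega>. (if ?A \<omega> then ?T n \<omega> else 0) + (if ?A \<omega> then 0 else ?T n \<omega>) * W (Suc n) \<omega> \<partial>M)"
      by (intro nn_integral_cong) simp
    also have "\<dots> = (\<integral>\<^sup>+\<omega>. (if ?A \<omega> then ?T n \<omega> else 0) \<partial>M) + (\<integral>\<^sup>+\<omega>. (if ?A \<omega> then 0 else ?T n \<omega>) * W (Suc n) \<omega> \<partial>M)"
      using WM[of "Suc n"] by (intro nn_integral_add) auto
    also have "\<dots> \<le> (\<integral>\<^sup>+\<omega>. (if ?A \<omega> then ?T n \<omega> else 0) \<partial>M) + (\<integral>\<^sup>+\<omega>. (if ?A \<omega> then 0 else ?T n \<omega>) \<partial>M)"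
      using T[of n] by (intro add_left_mono step) auto
    also have "\<dots> = (\<integral>\<^sup>+\<omega>. (if ?A \<omega> then ?T n \<omega> else 0) + (if ?A \<omega> then 0 else ?T n \<omega>) \<partial>M)"
      by (rule nn_integral_add[symmetric]) auto
    also have "\<dots> = (\<integral>\<^sup>+\<omega>. ?T n \<omega> \<partial>M)" by (intro nn_integral_cong) simp
    finally show ?case using Suc by (rule order_trans)
  qed
  have "measure M (E N) \<le> 1 / a" for N
  proof -
    have "ennreal a * emeasure M (E N) = (\<integral>\<^sup>+\<omega>. ennreal a * indicator (E N) \<omega> \<partial>M)"
      using E_sets by (simp add: nn_integral_cmult_indicator)
    also have "\<dots> \<le> (\<integral>\<^sup>+\<omega>. ?T N \<omega> \<partial>M)"
    proof (intro nn_integral_mono)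
      fix \<omega> show "ennreal a * indicator (E N) \<omega> \<le> ?T N \<omega>"
        using stopped_prod_cases[of N "ennreal a" W \<omega>] by (auto simp: E_def indicator_def)
    qed
    finally have "ennreal (a * measure M (E N)) \<le> 1"
      using int[of N] a by (simp add: emeasure_eq_measure ennreal_mult)
    then show ?thesis using a by (simp add: field_simps ennreal_le_1)
  qed
  moreover have "(\<lambda>N. measure M (E N)) \<longlonglongrightarrow> measure M (\<Union>N. E N)"
    using E_sets by (intro finite_Lim_measure_incseq) (auto simp: incseq_def E_def intro: order_trans simp del: One_nat_def)
  ultimately have "measure M (\<Union>N. E N) \<le> 1 / a" by (meson LIMSEQ_le_const2)
  moreover have eq: "(\<Union>N. E N) = {\<omega>\<in>space M. \<exists>n. ennreal a \<le> (\<Prod>i=1..n. W i \<omega>)}"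
    by (auto simp: E_def)
  ultimately show "measure M {\<omega>\<in>space M. \<exists>n. ennreal a \<le> (\<Prod>i=1..n. W i \<omega>)} \<le> 1 / a" by simp
  have "(\<Union>N. E N) \<in> sets M" using E_sets by auto
  then show "{\<omega>\<in>space M. \<exists>n. ennreal a \<le> (\<Prod>i=1..n. W i \<omega>)} \<in> sets M" by (simp add: eq)
qed

section \<open>The upper half of the iterated logarithm law\<close>

locale adapted_process = prob_space M for M :: "'a measure" +
  fixes F :: "nat \<Rightarrow> 'a measure" and X :: "nat \<Rightarrow> 'a \<Rightarrow> real" and K :: "nat \<Rightarrow> 'a \<Rightarrow> real measure"
  assumes filtration: "filtration (space M) F"
    and subalgebra: "\<And>n. subalgebra M (F n)"
    and adapted: "\<And>n. n \<ge> 1 \<Longrightarrow> X n \<in> borel_measurable (F n)"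
    and cond_distr: "\<And>i. i \<ge> 1 \<Longrightarrow> regular_cond_distr M (F (i - 1)) (X i) (K i)"
begin

lemma kernel:
  assumes "i \<ge> 1"
  shows "K i \<in> measurable (F (i - 1)) (prob_algebra borel)"
    and "\<omega> \<in> space M \<Longrightarrow> prob_space (K i \<omega>)"
    and "\<omega> \<in> space M \<Longrightarrow> sets (K i \<omega>) = sets borel"
proof -
  show K: "K i \<in> measurable (F (i - 1)) (prob_algebra borel)"
    using cond_distr[OF assms] by (simp add: regular_cond_distr_def)
  show "prob_space (K i \<omega>)" "sets (K i \<omega>) = sets borel" if "\<omega> \<in> space M"
    using measurable_space[OF K] that subalgebra[of "i - 1"]
    by (auto simp: space_prob_algebra subalgebra_def)
qed

text \<open>
  The product of the one-step factors is the exponential of the expression in \<open>E\<close>, so this is the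
  maximal inequality at level \<open>exp r\<close>. It holds simultaneously for all \<open>n\<close>, hence also at the random
  times at which \<open>V_norm X n\<close> visits a block.
\<close>

lemma deviation_inequality:
  fixes g C t c d r :: real
  assumes g: "0 < g" "g < 1" and C: "C_gam g \<le> C" and t: "0 < t"
    and c: "0 < c" "t * c \<le> g" and d: "1 \<le> C * t * d"
  defines "E \<equiv> {\<omega>\<in>space M. \<exists>n. r \<le> t * (partial_sum X n \<omega> -
      (\<Sum>i=1..n. cond_trunc_mean (K i) (- c) d \<omega>)) - C * t\<^sup>2 * (V_norm X n \<omega>)\<^sup>2}"
  shows "prob E \<le> exp (- r)" and "E \<in> events"
proof -
  define w where "w = (\<lambda>i \<omega>. t * (X i \<omega> - cond_trunc_mean (K i) (- c) d \<omega>) - C * t\<^sup>2 * (X i \<omega>)\<^sup>2)"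
  define W where "W = (\<lambda>i \<omega>. ennreal (exp (w i \<omega>)))"
  have prod: "(\<Prod>i=1..n. W i \<omega>) = ennreal (exp (\<Sum>i=1..n. w i \<omega>))" for n \<omega>
    by (simp add: W_def prod_ennreal exp_sum)
  have sum: "(\<Sum>i=1..n. w i \<omega>) = t * (partial_sum X n \<omega> -
      (\<Sum>i=1..n. cond_trunc_mean (K i) (- c) d \<omega>)) - C * t\<^sup>2 * (V_norm X n \<omega>)\<^sup>2" for n \<omega>
    by (simp add: w_def partial_sum_def V_norm_def sum_nonneg sum_subtractf sum_distrib_left
        right_diff_distrib)
  have E: "E = {\<omega>\<in>space M. \<exists>n. ennreal (exp r) \<le> (\<Prod>i=1..n. W i \<omega>)}"
    unfolding E_def prod sum by simp
  have W: "W n \<in> borel_measurable (F n)" if n: "n \<ge> 1" for n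
  proof -
    have sets: "sets (F (n - 1)) \<subseteq> sets (F n)" and space: "space (F (n - 1)) = space (F n)"
      using filtration unfolding filtration_def by auto
    have "cond_trunc_mean (K n) (- c) d \<in> borel_measurable (F n)"
      using cond_trunc_mean_measurable[OF kernel(1)[OF n], of "- c" d] sets space
      by (auto simp: measurable_def)
    then show ?thesis using adapted[OF n] unfolding W_def w_def by measurable
  qed
  have step: "(\<integral>\<^sup>+\<omega>. Z \<omega> * W n \<omega> \<partial>M) \<le> (\<integral>\<^sup>+\<omega>. Z \<omega> \<partial>M)"
    if "n \<ge> 1" "Z \<in> borel_measurable (F (n - 1))" for n Z
    unfolding W_def w_def
    by (rule nn_integral_exp_step[OF prob_space_axioms subalgebra
          measurable_from_subalg[OF subalgebra adapted] cond_distr that(2) g C t c d])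
       (use that in auto)
  note max = maximal_inequality[where F = F and W = W and a = "exp r",
      OF prob_space_axioms subalgebra filtration W step exp_gt_zero]
  show "prob E \<le> exp (- r)" using max(1) by (simp only: E exp_minus inverse_eq_divide)
  show "E \<in> events" unfolding E by (rule max(2))
qed

text \<open>
  If the ratio exceeds \<open>(1 + \<epsilon>) b_lam l\<close> at a time \<open>n\<close> with \<open>\<rho> ^ k \<le> V_norm X n \<omega> < \<rho> ^ (k + 1)\<close>, then
  the supermartingale belonging to block \<open>k\<close> exceeds \<open>exp (q * ln (ln (\<rho> ^ k)))\<close> with \<open>q > 1\<close>. The
  probabilities of these events are summable in \<open>k\<close>, so by the Borel-Cantelli lemma almost surely only
  finitely many blocks are affected, and \<open>V_norm X n \<omega>\<close> leaves those when it tends to infinity.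
\<close>

lemma eventually_le_b_lam:
  fixes l \<epsilon> :: real
  assumes l: "l > 0" and \<epsilon>: "\<epsilon> > 0"
  shows "AE \<omega> in M. filterlim (\<lambda>n. V_norm X n \<omega>) at_top sequentially \<longrightarrow>
    eventually (\<lambda>n. (partial_sum X n \<omega> - (\<Sum>i=1..n. cond_trunc_mean (K i)
        (- l * v_norm X n \<omega>) (a_lam l * v_norm X n \<omega>) \<omega>))
      / (V_norm X n \<omega> * sqrt (ln (ln (V_norm X n \<omega>)))) \<le> (1 + \<epsilon>) * b_lam l) sequentially"
proof -
  define g where "g = gam l"
  define A where "A = b_lam l * g / l"
  define B where "B = C_gam g * g\<^sup>2 / l\<^sup>2"
  have g: "0 < g" "g < 1" using gam_bounds[OF l] by (auto simp: g_def)
  have b: "b_lam l > 0" using h_lam_pos[OF l] l by (simp add: b_lam_def)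
  have Cg: "C_gam g > 0" using C_gam_ge_half[OF g] by simp
  have AB: "A - B = 1" unfolding A_def B_def g_def by (rule exponent_constant_eq_1[OF l])
  have A0: "A > 0" using b g l by (simp add: A_def)
  have al: "a_lam l > 0" using l g Cg by (simp add: a_lam_def g_def)
  obtain \<rho> where \<rho>: "\<rho> > 1" and q\<rho>: "(1 + \<epsilon>) * A / \<rho> - \<rho>\<^sup>2 * B > 1 + \<epsilon> * A / 2"
    using exists_grid_ratio[OF AB A0 \<epsilon>] by blast
  define q where "q = 1 + \<epsilon> * A / 2"
  have q: "q > 1" using \<epsilon> A0 by (simp add: q_def)
  \<comment> \<open>\<open>L k = ln (ln (\<rho> ^ k))\<close>.\<close>
  define L where "L = (\<lambda>k::nat. ln (real k * ln \<rho>))"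
  obtain k0 where k0: "\<And>k. k \<ge> k0 \<Longrightarrow> 0 < L k \<and> L (Suc k) \<le> \<rho>\<^sup>2 * L k"
    using loglog_grid_eventually[of "ln \<rho>" \<rho>] \<rho> unfolding L_def eventually_sequentially by auto
  \<comment> \<open>\<open>D k\<close> bounds \<open>v_norm X n \<omega>\<close> from above on block \<open>k\<close>, and \<open>D k / \<rho>\<^sup>2\<close> bounds it from below. The
    parameter \<open>t k\<close> is chosen so that \<open>t k * (l * D k) = g\<close>, the largest value allowed by the truncation.\<close>
  define D where "D = (\<lambda>k. \<rho> * \<rho> ^ k / sqrt (L k))"
  define t where "t = (\<lambda>k. g / (l * D k))"
  define C where "C = C_gam g * \<rho>\<^sup>2"
  \<comment> \<open>For small \<open>k\<close> the number \<open>L k\<close> need not be positive; the event is then set to be empty.\<close>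
  define Ev where "Ev = (\<lambda>k. if k \<ge> k0 then {\<omega>\<in>space M. \<exists>n. q * L k \<le> t k * (partial_sum X n \<omega> -
      (\<Sum>i=1..n. cond_trunc_mean (K i) (- (l * D k)) (a_lam l * (D k / \<rho>\<^sup>2)) \<omega>))
        - C * (t k)\<^sup>2 * (V_norm X n \<omega>)\<^sup>2} else {})"
  have Dpos: "D k > 0" if "k \<ge> k0" for k using k0[OF that] \<rho> by (simp add: D_def)
  have tpos: "t k > 0" if "k \<ge> k0" for k using Dpos[OF that] g l by (simp add: t_def)
  have CC: "C_gam g \<le> C" using Cg \<rho> by (simp add: C_def)
  have Ev: "prob (Ev k) \<le> exp (- (q * L k)) \<and> Ev k \<in> events" for k
  proof (cases "k \<ge> k0")
    case k: True
    have ne: "D k \<noteq> 0" "l \<noteq> 0" "g \<noteq> 0" "C_gam g \<noteq> 0" "\<rho> \<noteq> 0"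
      using Dpos[OF k] l g Cg \<rho> by auto
    have 1: "0 < l * D k" using l Dpos[OF k] by simp
    have 2: "t k * (l * D k) \<le> g" using ne by (simp add: t_def)
    have "a_lam l = l / (g * C_gam g)" by (simp add: a_lam_def g_def)
    then have 3: "1 \<le> C * t k * (a_lam l * (D k / \<rho>\<^sup>2))"
      using ne by (simp add: C_def t_def)
    show ?thesis
      using deviation_inequality[OF g CC tpos[OF k] 1 2 3, of "q * L k"] k by (simp add: Ev_def)
  next
    case False
    then show ?thesis by (simp add: Ev_def)
  qed
  have "summable (\<lambda>k. exp (- (q * L k)))"
    unfolding L_def using \<rho> q by (intro summable_exp_loglog_grid) auto
  then have "summable (\<lambda>k. prob (Ev k))"
    by (rule summable_comparison_test') (use Ev in auto)
  then have "AE \<omega> in M. eventually (\<lambda>k. \<omega> \<in> space M - Ev k) sequentially"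
    by (intro borel_cantelli_AE1) (auto simp: Ev less_top[symmetric])
  then show ?thesis
  proof (eventually_elim, intro impI)
    fix \<omega> assume "eventually (\<lambda>k. \<omega> \<in> space M - Ev k) sequentially"
      and V: "filterlim (\<lambda>n. V_norm X n \<omega>) at_top sequentially"
    then obtain k1 where k1: "\<And>k. k \<ge> k1 \<Longrightarrow> \<omega> \<in> space M - Ev k"
      by (auto simp: eventually_sequentially)
    \<comment> \<open>From the time when \<open>V_norm X n \<omega>\<close> passes \<open>\<rho> ^ k2\<close>, it only visits blocks with estimates and without
      exceptional event.\<close>
    define k2 where "k2 = max k0 k1"
    have "eventually (\<lambda>n. V_norm X n \<omega> \<ge> \<rho> ^ k2) sequentially"
      using V by (simp add: filterlim_at_top)
    then show "eventually (\<lambda>n. (partial_sum X n \<omega> - (\<Sum>i=1..n. cond_trunc_mean (K i)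
        (- l * v_norm X n \<omega>) (a_lam l * v_norm X n \<omega>) \<omega>))
      / (V_norm X n \<omega> * sqrt (ln (ln (V_norm X n \<omega>)))) \<le> (1 + \<epsilon>) * b_lam l) sequentially"
    proof eventually_elim
      fix n assume n: "V_norm X n \<omega> \<ge> \<rho> ^ k2"
      define V where "V = V_norm X n \<omega>"
      obtain k where k2: "k2 \<le> k" and Vlow: "\<rho> ^ k \<le> V" and Vup: "V < \<rho> ^ Suc k"
        using exists_geometric_block[OF \<rho>, of k2 V] n by (auto simp: V_def)
      have k: "k \<ge> k0" "k \<ge> k1" using k2 by (auto simp: k2_def)
      have Lk: "0 < L k" "L (Suc k) \<le> \<rho>\<^sup>2 * L k" using k0[OF k(1)] by auto
      have kpos: "k > 0" using Lk(1) by (cases k) (auto simp: L_def)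
      define LV where "LV = ln (ln V)"
      have LV: "L k \<le> LV" "LV \<le> \<rho>\<^sup>2 * L k"
        using loglog_in_block[OF \<rho> Vlow Vup kpos] Lk(2) unfolding LV_def L_def by linarith+
      have e: "0 < \<rho> ^ k" "V \<le> \<rho> * \<rho> ^ k" using \<rho> Vup by auto
      have V0: "V > 0" and LV0: "LV > 0" using e Vlow LV Lk by linarith+
      have vV: "v_norm X n \<omega> = V / sqrt LV"
        using LV0 by (simp add: v_norm_def V_def[symmetric] LV_def[symmetric] powr_minus_divide powr_half_sqrt)
      have v: "V / sqrt LV \<le> D k" "D k / \<rho>\<^sup>2 \<le> V / sqrt LV"
        using normalizer_in_block[OF \<rho> e(1) Vlow e(2) Lk(1) LV] by (auto simp: D_def)
      have w: "\<omega> \<in> space M" "\<omega> \<notin> Ev k" using k1[OF k(2)] by auto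
      let ?S = "partial_sum X n \<omega>"
      let ?m = "\<Sum>i=1..n. cond_trunc_mean (K i) (- (l * D k)) (a_lam l * (D k / \<rho>\<^sup>2)) \<omega>"
      let ?m' = "\<Sum>i=1..n. cond_trunc_mean (K i) (- l * v_norm X n \<omega>) (a_lam l * v_norm X n \<omega>) \<omega>"
      have "?m \<le> ?m'"
      proof (rule sum_mono)
        fix i assume "i \<in> {1..n}"
        then have i: "i \<ge> 1" by simp
        have "l * (V / sqrt LV) \<le> l * D k" using v(1) l by (intro mult_left_mono) auto
        then have 1: "- (l * D k) \<le> - l * v_norm X n \<omega>" by (simp add: vV)
        have 2: "- l * v_norm X n \<omega> \<le> 0" using l V0 LV0 by (simp add: vV)
        have 3: "0 \<le> a_lam l * (D k / \<rho>\<^sup>2)" using al Dpos[OF k(1)] by simp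
        have 4: "a_lam l * (D k / \<rho>\<^sup>2) \<le> a_lam l * v_norm X n \<omega>"
          using v(2) al unfolding vV by (intro mult_left_mono) auto
        show "cond_trunc_mean (K i) (- (l * D k)) (a_lam l * (D k / \<rho>\<^sup>2)) \<omega>
          \<le> cond_trunc_mean (K i) (- l * v_norm X n \<omega>) (a_lam l * v_norm X n \<omega>) \<omega>"
          by (rule cond_trunc_mean_mono[where K = "K i" and \<omega> = \<omega>, OF kernel(2)[OF i w(1)] kernel(3)[OF i w(1)] 1 2 3 4])
      qed
      have "\<not> (?S - ?m' > (1 + \<epsilon>) * b_lam l * (V * sqrt LV))"
      proof
        assume "?S - ?m' > (1 + \<epsilon>) * b_lam l * (V * sqrt LV)"
        then have dev: "(1 + \<epsilon>) * b_lam l * (V * sqrt LV) \<le> ?S - ?m"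
          using \<open>?m \<le> ?m'\<close> by linarith
        have tk: "t k = g / (l * (\<rho> * \<rho> ^ k / sqrt (L k)))" by (simp only: t_def D_def)
        have "((1 + \<epsilon>) * A / \<rho> - \<rho>\<^sup>2 * B) * L k \<le> t k * (?S - ?m) - C * (t k)\<^sup>2 * V\<^sup>2"
          unfolding A_def B_def C_def
          by (rule exponent_in_block[OF b g(1) l Cg \<epsilon> \<rho> e(1) Vlow e(2) Lk(1) LV(1) dev tk])
        moreover have "q * L k \<le> ((1 + \<epsilon>) * A / \<rho> - \<rho>\<^sup>2 * B) * L k"
          using less_imp_le[OF q\<rho>] less_imp_le[OF Lk(1)] unfolding q_def by (rule mult_right_mono)
        ultimately have "q * L k \<le> t k * (?S - ?m) - C * (t k)\<^sup>2 * V\<^sup>2" by linarith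
        then have "\<omega> \<in> Ev k" using w k by (auto simp: Ev_def V_def)
        then show False using w by simp
      qed
      then show "(?S - ?m') / (V_norm X n \<omega> * sqrt (ln (ln (V_norm X n \<omega>)))) \<le> (1 + \<epsilon>) * b_lam l"
        using mult_pos_pos[OF V0 real_sqrt_gt_zero[OF LV0]]
        unfolding V_def[symmetric] LV_def[symmetric] not_less by (rule pos_divide_le_eq[THEN iffD2, rotated])
    qed
  qed
qed

lemma limsup_le_b_lam:
  assumes l: "l > 0"
  shows "AE \<omega> in M. filterlim (\<lambda>n. V_norm X n \<omega>) at_top sequentially \<longrightarrow>
            limsup (\<lambda>n. ereal
              ((partial_sum X n \<omega> - (\<Sum>i=1..n. cond_trunc_mean (K i) (- l * v_norm X n \<omega>) (a_lam l * v_norm X n \<omega>) \<omega>))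
                 / (V_norm X n \<omega> * sqrt (ln (ln (V_norm X n \<omega>))))))
            \<le> ereal (b_lam l)"
proof -
  have "AE \<omega> in M. \<forall>j. filterlim (\<lambda>n. V_norm X n \<omega>) at_top sequentially \<longrightarrow>
    eventually (\<lambda>n. (partial_sum X n \<omega> - (\<Sum>i=1..n. cond_trunc_mean (K i)
        (- l * v_norm X n \<omega>) (a_lam l * v_norm X n \<omega>) \<omega>))
      / (V_norm X n \<omega> * sqrt (ln (ln (V_norm X n \<omega>)))) \<le> (1 + inverse (real (Suc j))) * b_lam l) sequentially"
    unfolding AE_all_countable by (intro allI eventually_le_b_lam l) simp
  then show ?thesis
  proof (eventually_elim, intro impI)
    fix \<omega>
    let ?R = "\<lambda>n. (partial_sum X n \<omega> - (\<Sum>i=1..n. cond_trunc_mean (K i)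
        (- l * v_norm X n \<omega>) (a_lam l * v_norm X n \<omega>) \<omega>))
      / (V_norm X n \<omega> * sqrt (ln (ln (V_norm X n \<omega>))))"
    assume "\<forall>j. filterlim (\<lambda>n. V_norm X n \<omega>) at_top sequentially \<longrightarrow>
        eventually (\<lambda>n. ?R n \<le> (1 + inverse (real (Suc j))) * b_lam l) sequentially"
      and "filterlim (\<lambda>n. V_norm X n \<omega>) at_top sequentially"
    then have "limsup (\<lambda>n. ereal (?R n)) \<le> ereal ((1 + inverse (real (Suc j))) * b_lam l)" for j
      by (intro Limsup_bounded) auto
    moreover have "(\<lambda>j. (1 + inverse (real (Suc j))) * b_lam l) \<longlonglongrightarrow> (1 + 0) * b_lam l"
      by (intro tendsto_intros LIMSEQ_inverse_real_of_nat)
    then have "(\<lambda>j. ereal ((1 + inverse (real (Suc j))) * b_lam l)) \<longlonglongrightarrow> ereal (b_lam l)"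
      by simp
    ultimately show "limsup (\<lambda>n. ereal (?R n)) \<le> ereal (b_lam l)"
      by (meson LIMSEQ_le_const)
  qed
qed

end

theorem theorem5p4:
  fixes M :: "'a measure" and F :: "nat \<Rightarrow> 'a measure"
    and X :: "nat \<Rightarrow> 'a \<Rightarrow> real" and K :: "nat \<Rightarrow> 'a \<Rightarrow> real measure"
  assumes "prob_space M"
    and "filtration (space M) F"
    and "\<And>n. subalgebra M (F n)"
    and "\<And>n. n \<ge> 1 \<Longrightarrow> X n \<in> borel_measurable (F n)"
    and "\<And>i. i \<ge> 1 \<Longrightarrow> regular_cond_distr M (F (i - 1)) (X i) (K i)"
  shows "(\<forall>l>0. AE \<omega> in M. filterlim (\<lambda>n. V_norm X n \<omega>) at_top sequentially \<longrightarrow>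
            limsup (\<lambda>n. ereal
              ((partial_sum X n \<omega> - (\<Sum>i=1..n. cond_trunc_mean (K i) (- l * v_norm X n \<omega>) (a_lam l * v_norm X n \<omega>) \<omega>))
                 / (V_norm X n \<omega> * sqrt (ln (ln (V_norm X n \<omega>))))))
            \<le> ereal (b_lam l))
         \<and> (b_lam \<longlongrightarrow> sqrt 2) (at_right 0)"
proof -
  interpret adapted_process M F X K
    using assms by (intro adapted_process.intro adapted_process_axioms.intro)
  show ?thesis using limsup_le_b_lam b_lam_tendsto by blast
qed

end
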